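(* If $64|V(\Gamma)|\le n+1$, then the classical searching time satisfies $t_c=\Theta\!\left(\dfrac{n^2}{|E(\Gamma)|}\right)$; that is, there exist absolute constants $0<c_1\le c_2$ such that for every $n\ge 2$ and every subgraph $\Gamma$ of $K_{n+1}$ as in the context with $64|V(\Gamma)|\le n+1$, $$c_1\frac{n^2}{|E(\Gamma)|}\le t_c\le c_2\frac{n^2}{|E(\Gamma)|}.$$
   Context: Let $n\ge 2$ and $G=K_{n+1}$. $\Gamma$ is a subgraph of $G$ with at least one edge whose vertex set is exactly the set of endpoints of its edges. $\Delta$ is the graph with vertex set $V(G)$ obtained from $G$ by removing all edges of $\Gamma$. $L(\Delta)$ is the line graph of $\Delta$, $A(\cdot)$ denotes adjacency matrix, and $P_\Gamma=\frac{1}{2(n-1)}A(L(\Delta))$, a symmetric matrix indexed by $E(\Delta)$. $\mathbf{j}_{E(\Delta)}$ is the normalized (unit Euclidean length) all-ones vector indexed by $E(\Delta)$. The classical searching time (expected first hitting time of a marked edge, i.e. an edge of $\Gamma$, for the isotropic random walk on the line graph of $G$ started from the edges of $\Delta$) is given by $t_c=\mathbf{j}_{E(\Delta)}^\top (I-P_\Gamma)^{-1}\mathbf{j}_{E(\Delta)}$; the largest eigenvalue of $P_\Gamma$ is less than $1$ under the hypothesis, so the inverse exists. *)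

theory Defs
  imports
    Complex_Main
    "HOL-Combinatorics.Multiset_Permutations"
    "Jordan_Normal_Form.Gauss_Jordan_Elimination"
begin

text \<open>Simple undirected graphs; an edge is the two-element set of its endpoints.\<close>

record 'v ugraph =
  verts :: "'v set"
  edges :: "'v set set"

definition simple_graph :: "'v ugraph \<Rightarrow> bool" where
  "simple_graph G \<longleftrightarrow> edges G \<subseteq> {e. e \<subseteq> verts G \<and> card e = 2}"

definition subgraph_of :: "'v ugraph \<Rightarrow> 'v ugraph \<Rightarrow> bool" where
  "subgraph_of H G \<longleftrightarrow> simple_graph H \<and> verts H \<subseteq> verts G \<and> edges H \<subseteq> edges G"

text \<open>The complete graph on \<open>m\<close> vertices, labelled \<open>0, \<dots>, m - 1\<close>.\<close>

definition complete_graph :: "nat \<Rightarrow> nat ugraph" where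
  "complete_graph m = \<lparr>verts = {..<m}, edges = {e. e \<subseteq> {..<m} \<and> card e = 2}\<rparr>"

definition delete_edges :: "'v ugraph \<Rightarrow> 'v set set \<Rightarrow> 'v ugraph" where
  "delete_edges G F = \<lparr>verts = verts G, edges = edges G - F\<rparr>"

definition line_graph :: "'v ugraph \<Rightarrow> 'v set ugraph" where
  "line_graph G = \<lparr>verts = edges G,
     edges = {{e, f} | e f. e \<in> edges G \<and> f \<in> edges G \<and> e \<noteq> f \<and> e \<inter> f \<noteq> {}}\<rparr>"

text \<open>
  Library matrices have rows and columns numbered from \<open>0\<close>. A matrix indexed by the vertex set
  of a graph is therefore taken relative to a list \<open>vs\<close> enumerating that set without repetition.
\<close>

definition adjacency_matrix :: "'v list \<Rightarrow> 'v ugraph \<Rightarrow> real mat" where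
  "adjacency_matrix vs G =
     mat (length vs) (length vs) (\<lambda>(i, j). if {vs ! i, vs ! j} \<in> edges G then 1 else 0)"

definition marked_subgraph :: "nat \<Rightarrow> nat ugraph \<Rightarrow> bool" where
  "marked_subgraph n \<Gamma> \<longleftrightarrow>
     subgraph_of \<Gamma> (complete_graph (n + 1)) \<and> edges \<Gamma> \<noteq> {} \<and> verts \<Gamma> = \<Union> (edges \<Gamma>)"

definition unmarked_graph :: "nat \<Rightarrow> nat ugraph \<Rightarrow> nat ugraph" where
  "unmarked_graph n \<Gamma> = delete_edges (complete_graph (n + 1)) (edges \<Gamma>)"

text \<open>
  Below, \<open>es\<close> is an enumeration of the edges of the unmarked graph, i.e. of the vertices of its
  line graph. The factor \<open>2 (n - 1)\<close> is the degree of the line graph of the whole complete graph.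
\<close>

definition P_matrix :: "nat \<Rightarrow> nat ugraph \<Rightarrow> nat set list \<Rightarrow> real mat" where
  "P_matrix n \<Gamma> es =
     (1 / (2 * (real n - 1))) \<cdot>\<^sub>m adjacency_matrix es (line_graph (unmarked_graph n \<Gamma>))"

definition unit_ones_vec :: "nat \<Rightarrow> real vec" where
  "unit_ones_vec m = vec m (\<lambda>_. 1 / sqrt (real m))"

text \<open>
  The value is unspecified if \<open>I - P\<close> is singular (\<open>mat_inverse\<close> returns \<open>None\<close>), so any bound
  on it requires showing that the inverse exists.
\<close>

definition classical_time :: "nat \<Rightarrow> nat ugraph \<Rightarrow> nat set list \<Rightarrow> real" where
  "classical_time n \<Gamma> es =
     (let m = length es in
      unit_ones_vec m \<bullet>
        (the (mat_inverse (1\<^sub>m m - P_matrix n \<Gamma> es)) *\<^sub>v unit_ones_vec m))"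

end

theory Submission
  imports Defs "Jordan_Normal_Form.Determinant"
begin

text \<open>
  Write $g = |E(\Gamma)|$, let $d$ be the vertex degree in $\Gamma$, $s(uv) = d(u) + d(v)$, and
  $h_c(e) = \frac{n-1}{2g}(c - s(e))$. For an unmarked edge $e$, counting the neighbours of $e$ in
  the line graph of $K_{n+1}$ (handshake lemma) and subtracting the marked ones gives
  $((I-P)h_c)(e) = 1 + \frac{1}{4g}\bigl(\sum_{f \sim e,\ f \in E(\Gamma)} (c - s(f)) - (n+1)s(e)\bigr)$,
  where the sum has exactly $s(e)$ terms. Since $0 \le s(f) \le 2|V(\Gamma)|$, this is at least 1
  for $c = 2(n+1)$ and at most 1 for $c = n-1$. As $I-P$ has nonpositive off-diagonal entries, the
  discrete minimum principle makes it invertible and places the hitting times $(I-P)^{-1}\mathbf{1}$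
  pointwise between $h_{n-1}$ and $h_{2(n+1)}$, both of order $n^2/g$.
\<close>

section \<open>Minimum principle and invertibility for matrices with nonpositive off-diagonal
  entries\<close>

text \<open>Choose \<open>i\<close> minimising the ratio \<open>r\<close> of \<open>x\<close> to
  \<open>h\<close>. Then \<open>x - r h\<close> is nonnegative and vanishes at \<open>i\<close>, so
  row \<open>i\<close> of \<open>A\<close> sends it to a number at most 0. If \<open>r\<close> were
  negative, \<open>(A x) $ i - r * (A h) $ i\<close> would be positive.\<close>

lemma nonneg_if_mult_nonneg:
  fixes A :: "real mat" and h :: "nat \<Rightarrow> real"
  assumes A: "A \<in> carrier_mat m m" and x: "x \<in> carrier_vec m"
    and off: "\<And>i j. i < m \<Longrightarrow> j < m \<Longrightarrow> i \<noteq> j \<Longrightarrow> A $$ (i, j) \<le> 0"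
    and h: "\<And>i. i < m \<Longrightarrow> h i > 0"
    and Ah: "\<And>i. i < m \<Longrightarrow> (A *\<^sub>v vec m h) $ i > 0"
    and Ax: "\<And>i. i < m \<Longrightarrow> (A *\<^sub>v x) $ i \<ge> 0"
    and k: "k < m"
  shows "x $ k \<ge> 0"
proof (rule ccontr)
  assume neg: "\<not> x $ k \<ge> 0"
  define i where "i = arg_min_on (\<lambda>i. x $ i / h i) {..<m}"
  have i: "i < m" and least: "\<And>j. j < m \<Longrightarrow> x $ i / h i \<le> x $ j / h j"
    using arg_min_if_finite[of "{..<m}" "\<lambda>i. x $ i / h i"] k
      arg_min_least[of "{..<m}" _ "\<lambda>i. x $ i / h i"] unfolding i_def by auto
  define r where "r = x $ i / h i"
  have "r \<le> x $ k / h k" using least[OF k] by (simp add: r_def)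
  also have "\<dots> < 0" using neg h[OF k] by (simp add: divide_neg_pos)
  finally have r: "r < 0" .
  have y: "x $ j - r * h j \<ge> 0" if "j < m" for j
    using least[OF that] h[OF that] by (simp add: r_def pos_le_divide_eq)
  have yi: "x $ i - r * h i = 0" using h[OF i] by (simp add: r_def)
  have row: "(A *\<^sub>v v) $ i = (\<Sum>j<m. A $$ (i, j) * v $ j)" if "v \<in> carrier_vec m" for v
    using that A i by (auto simp: scalar_prod_def atLeast0LessThan intro!: sum.cong)
  have "(A *\<^sub>v x) $ i - r * (A *\<^sub>v vec m h) $ i = (\<Sum>j<m. A $$ (i, j) * (x $ j - r * h j))"
    by (simp add: row x sum_distrib_left sum_subtractf algebra_simps)
  also have "\<dots> \<le> 0"
  proof (rule sum_nonpos)
    fix j assume j: "j \<in> {..<m}"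
    show "A $$ (i, j) * (x $ j - r * h j) \<le> 0"
      \<comment> \<open>The diagonal term is zero by \<open>yi\<close>; every other term is a
        nonpositive entry times a nonnegative number.\<close>
      using off[OF i, of j] y[of j] yi j by (cases "j = i") (auto intro: mult_nonpos_nonneg)
  qed
  finally show False
    using Ax[OF i] mult_neg_pos[OF r Ah[OF i]] by linarith
qed

text \<open>The minimum principle applies to a kernel vector and to its negative, so the kernel is
  trivial and the determinant is nonzero. This is what guarantees that
  \<open>the (mat_inverse A)\<close> in \<open>classical_time\<close> denotes a genuine
  inverse.\<close>

lemma mat_inverse_if_mult_pos:
  fixes A :: "real mat" and h :: "nat \<Rightarrow> real"
  assumes A: "A \<in> carrier_mat m m"
    and off: "\<And>i j. i < m \<Longrightarrow> j < m \<Longrightarrow> i \<noteq> j \<Longrightarrow> A $$ (i, j) \<le> 0"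
    and h: "\<And>i. i < m \<Longrightarrow> h i > 0"
    and Ah: "\<And>i. i < m \<Longrightarrow> (A *\<^sub>v vec m h) $ i > 0"
  obtains B where "mat_inverse A = Some B" "B \<in> carrier_mat m m" "A * B = 1\<^sub>m m"
proof (cases "mat_inverse A")
  case None
  have "det A \<noteq> 0"
  proof
    assume "det A = 0"
    then obtain v where v: "v \<in> carrier_vec m" "v \<noteq> 0\<^sub>v m" "A *\<^sub>v v = 0\<^sub>v m"
      using det_0_iff_vec_prod_zero_field[OF A] by auto
    have "A *\<^sub>v (- v) = - (A *\<^sub>v v)"
      using v(1) A by (intro eq_vecI) auto
    then have Av: "A *\<^sub>v (- v) = 0\<^sub>v m" using v(3) by simp
    have "v $ i = 0" if "i < m" for i
      using nonneg_if_mult_nonneg[OF A _ off h Ah _ that, of v]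
        nonneg_if_mult_nonneg[OF A _ off h Ah _ that, of "- v"] v Av that by auto
    with v show False by (metis carrier_vecD eq_vecI index_zero_vec)
  qed
  \<comment> \<open>The result \<open>None\<close> means that \<open>A\<close> is not a unit of the
    matrix ring; \<open>()\<close> fills the record extension of that ring in both facts so that
    they match.\<close>
  with mat_inverse(1)[OF A None, of "()"] det_non_zero_imp_unit[OF A, of "()"] show ?thesis by blast
next
  case (Some B)
  with mat_inverse(2)[OF A Some] that show ?thesis by blast
qed

section \<open>Degrees, edge weights and sums over adjacent edges\<close>

definition degree_in :: "'v set set \<Rightarrow> 'v \<Rightarrow> nat" where
  "degree_in F u = card {f \<in> F. u \<in> f}"

text \<open>The function s of the overview. For a two-element \<open>e\<close> outside a set
  \<open>F\<close> of two-element edges, it is the number of edges in \<open>F\<close> adjacent to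
  \<open>e\<close>.\<close>

definition edge_weight :: "'v set set \<Rightarrow> 'v set \<Rightarrow> real" where
  "edge_weight F e = (\<Sum>u\<in>e. real (degree_in F u))"

lemma edge_weight_doubleton:
  "u \<noteq> v \<Longrightarrow> edge_weight F {u, v} = real (degree_in F u) + real (degree_in F v)"
  by (simp add: edge_weight_def)

lemma degree_in_le:
  assumes "finite W" "\<And>f. f \<in> F \<Longrightarrow> f \<subseteq> W \<and> card f = 2"
  shows "degree_in F u \<le> card W"
proof -
  have "{f \<in> F. u \<in> f} \<subseteq> (\<lambda>w. {u, w}) ` W"
    using assms(2) by (fastforce simp: card_2_iff)
  then show ?thesis
    unfolding degree_in_def by (meson assms(1) card_image_le card_mono finite_imageI le_trans)
qed

text \<open>Handshake lemma, by double counting of incidences.\<close>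

lemma sum_degree_in:
  assumes "finite V" "finite F" "\<And>f. f \<in> F \<Longrightarrow> f \<subseteq> V \<and> card f = 2"
  shows "(\<Sum>u\<in>V. degree_in F u) = 2 * card F"
proof -
  have "card {u \<in> V. u \<in> f} = 2" if "f \<in> F" for f
    using assms(3)[OF that] by (metis Int_absorb1 Int_def)
  then show ?thesis
    using sum_multicount[of V F "\<lambda>u f. u \<in> f" 2] assms by (simp add: degree_in_def mult.commute)
qed

text \<open>The neighbours of \<open>{u, v}\<close> in the line graph of the complete graph on
  \<open>V\<close> form two disjoint families, one for each shared endpoint, both parametrised
  injectively by the other endpoint \<open>w\<close>.\<close>

lemma sum_adjacent_pairs:
  fixes h :: "'v set \<Rightarrow> real"
  assumes "finite V" "u \<in> V" "v \<in> V" "u \<noteq> v"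
  shows "(\<Sum>f | f \<subseteq> V \<and> card f = 2 \<and> f \<noteq> {u, v} \<and> {u, v} \<inter> f \<noteq> {}. h f) =
    (\<Sum>w\<in>V - {u, v}. h {u, w} + h {v, w})"
proof -
  have *: "{f. f \<subseteq> V \<and> card f = 2 \<and> f \<noteq> {u, v} \<and> {u, v} \<inter> f \<noteq> {}} =
      (\<lambda>w. {u, w}) ` (V - {u, v}) \<union> (\<lambda>w. {v, w}) ` (V - {u, v})" (is "?L = ?R")
  proof
    show "?L \<subseteq> ?R"
    proof
      fix f assume "f \<in> ?L"
      then obtain x y where "f = {x, y}" "x \<noteq> y" and f: "f \<in> ?L" by (auto simp: card_2_iff)
      then show "f \<in> ?R" by (auto simp: insert_commute doubleton_eq_iff)
    qed
    show "?R \<subseteq> ?L" using assms by (auto simp: doubleton_eq_iff)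
  qed
  have inj: "inj_on (\<lambda>w. {x, w}) (V - {u, v})" for x
    by (auto simp: inj_on_def doubleton_eq_iff)
  show ?thesis unfolding *
    using assms inj
    by (subst sum.union_disjoint) (auto simp: sum.reindex sum.distrib doubleton_eq_iff)
qed

text \<open>An edge containing both \<open>u\<close> and \<open>v\<close> would equal
  \<open>{u, v}\<close>, which is not in \<open>F\<close>; hence no edge is counted twice on the
  right.\<close>

lemma sum_adjacent_subset:
  fixes h :: "'v set \<Rightarrow> real"
  assumes "finite F" "\<And>f. f \<in> F \<Longrightarrow> card f = 2" "{u, v} \<notin> F" "u \<noteq> v"
  shows "(\<Sum>f | f \<in> F \<and> f \<noteq> {u, v} \<and> {u, v} \<inter> f \<noteq> {}. h f) =
    (\<Sum>f | f \<in> F \<and> u \<in> f. h f) + (\<Sum>f | f \<in> F \<and> v \<in> f. h f)"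
proof -
  have "\<not> (u \<in> f \<and> v \<in> f)" if "f \<in> F" for f
    using assms(2)[OF that] assms(3,4) that by (auto simp: card_2_iff insert_commute)
  moreover have "{f. f \<in> F \<and> f \<noteq> {u, v} \<and> {u, v} \<inter> f \<noteq> {}} =
      {f. f \<in> F \<and> u \<in> f} \<union> {f. f \<in> F \<and> v \<in> f}"
    using assms(3) by auto
  ultimately show ?thesis
    using assms(1) by (subst sum.union_disjoint[symmetric]) auto
qed

text \<open>The sum over all neighbours in the complete graph, minus the sum over the marked ones.
  The former is explicit by the handshake lemma; the latter is kept as a double sum, to be estimated
  later.\<close>

lemma sum_adjacent_weight:
  assumes "finite V" "F \<subseteq> {e. e \<subseteq> V \<and> card e = 2}"
    and e: "e \<subseteq> V" "card e = 2" "e \<notin> F"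
  shows "(\<Sum>f | f \<subseteq> V \<and> card f = 2 \<and> f \<notin> F \<and> f \<noteq> e \<and> e \<inter> f \<noteq> {}. c - edge_weight F f) =
    (real (card V) - 2) * (2 * c - edge_weight F e) - 2 * (2 * real (card F) - edge_weight F e)
    - (\<Sum>u\<in>e. \<Sum>f | f \<in> F \<and> u \<in> f. c - edge_weight F f)"
proof -
  obtain u v where uv: "e = {u, v}" "u \<noteq> v" using e by (auto simp: card_2_iff)
  let ?h = "\<lambda>f. c - edge_weight F f"
  let ?d = "\<lambda>u. real (degree_in F u)"
  let ?N = "{f. f \<subseteq> V \<and> card f = 2 \<and> f \<noteq> e \<and> e \<inter> f \<noteq> {}}"
  let ?M = "{f. f \<in> F \<and> f \<noteq> e \<and> e \<inter> f \<noteq> {}}"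
  have fin: "finite ?N" "finite F"
    using assms(1,2) by (auto intro: finite_subset[of _ "Pow V"])
  have "{f. f \<subseteq> V \<and> card f = 2 \<and> f \<notin> F \<and> f \<noteq> e \<and> e \<inter> f \<noteq> {}} = ?N - ?M" by auto
  moreover have "?M \<subseteq> ?N" using assms(2) by auto
  ultimately have "(\<Sum>f | f \<subseteq> V \<and> card f = 2 \<and> f \<notin> F \<and> f \<noteq> e \<and> e \<inter> f \<noteq> {}. ?h f) =
      sum ?h ?N - sum ?h ?M"
    using fin(1) by (simp add: sum_diff)
  moreover have "sum ?h ?M = (\<Sum>u\<in>e. \<Sum>f | f \<in> F \<and> u \<in> f. ?h f)"
    using sum_adjacent_subset[of F u v ?h] fin(2) assms(2) e(3) uv by auto
  moreover have "sum ?h ?N = (\<Sum>w\<in>V - {u, v}. ?h {u, w} + ?h {v, w})"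
    using sum_adjacent_pairs[of V u v ?h] assms(1) e uv by auto
  \<comment> \<open>The two edges at \<open>w\<close> together carry the degrees of \<open>u\<close>
    and \<open>v\<close> once each, which is the weight of \<open>e\<close>, and that of
    \<open>w\<close> twice.\<close>
  moreover have "\<dots> = (\<Sum>w\<in>V - {u, v}. (2 * c - edge_weight F e) - 2 * ?d w)"
    using uv by (intro sum.cong) (auto simp: edge_weight_doubleton)
  moreover have "\<dots> = (\<Sum>w\<in>V - {u, v}. 2 * c - edge_weight F e) - 2 * (\<Sum>w\<in>V - {u, v}. ?d w)"
    by (simp add: sum_subtractf sum_distrib_left)
  moreover have "(\<Sum>w\<in>V - {u, v}. ?d w) = 2 * real (card F) - edge_weight F e"
  proof -
    have "(\<Sum>w\<in>V. ?d w) = real (\<Sum>w\<in>V. degree_in F w)" by simp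
    also have "\<dots> = 2 * real (card F)"
      using assms(1,2) fin(2) by (subst sum_degree_in) auto
    finally have "(\<Sum>w\<in>V. ?d w) = 2 * real (card F)" .
    moreover have "(\<Sum>w\<in>V - {u, v}. ?d w) = (\<Sum>w\<in>V. ?d w) - (\<Sum>w\<in>{u, v}. ?d w)"
      using assms(1) e(1) uv by (intro sum_diff) auto
    ultimately show ?thesis using uv by (simp add: edge_weight_def)
  qed
  moreover have "real (card (V - {u, v})) = real (card V) - 2"
  proof -
    \<comment> \<open>The bound on \<open>card V\<close> turns the truncated subtraction into a real
      one.\<close>
    have "card (V - {u, v}) = card V - 2" "2 \<le> card V"
      using assms(1) e uv card_mono[of V e] by (auto simp: card_Diff_subset)
    then show ?thesis by simp
  qed
  ultimately show ?thesis by (simp only: sum_constant uv(1))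
qed

lemma edge_weight_nonneg: "edge_weight F e \<ge> 0"
  by (simp add: edge_weight_def sum_nonneg)

lemma edge_weight_le:
  assumes "finite W" "\<And>f. f \<in> F \<Longrightarrow> f \<subseteq> W \<and> card f = 2" "card e = 2"
  shows "edge_weight F e \<le> 2 * real (card W)"
  using sum_bounded_above[of e "\<lambda>u. real (degree_in F u)" "real (card W)"] assms(3)
    degree_in_le[OF assms(1,2)] by (simp add: edge_weight_def)

text \<open>The inner sum at \<open>u\<close> has \<open>degree_in F u\<close> terms, so there are
  \<open>edge_weight F e\<close> terms in all.\<close>

lemma sum_incident_le:
  assumes "\<And>f. f \<in> F \<Longrightarrow> (g f :: real) \<le> K"
  shows "(\<Sum>u\<in>e. \<Sum>f | f \<in> F \<and> u \<in> f. g f) \<le> K * edge_weight F e"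
  unfolding edge_weight_def sum_distrib_left degree_in_def
  using assms by (intro sum_mono) (metis (no_types, lifting) mem_Collect_eq mult.commute sum_bounded_above)

lemma sum_incident_ge:
  assumes "\<And>f. f \<in> F \<Longrightarrow> (g f :: real) \<ge> K"
  shows "(\<Sum>u\<in>e. \<Sum>f | f \<in> F \<and> u \<in> f. g f) \<ge> K * edge_weight F e"
  using sum_incident_le[of F "\<lambda>f. - g f" "- K" e] assms by (simp add: sum_negf)

section \<open>The walk matrix and its action on the test functions\<close>

lemma P_matrix_mult_vec:
  assumes es: "distinct es" "set es = edges (unmarked_graph n \<Gamma>)" and i: "i < length es"
  shows "(P_matrix n \<Gamma> es *\<^sub>v vec (length es) (\<lambda>j. h (es ! j))) $ i =
    (\<Sum>f | f \<in> set es \<and> f \<noteq> es ! i \<and> es ! i \<inter> f \<noteq> {}. h f) / (2 * (real n - 1))"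
proof -
  let ?adj = "\<lambda>f. f \<noteq> es ! i \<and> es ! i \<inter> f \<noteq> {}"
  \<comment> \<open>On the diagonal the pair collapses to a singleton, which is no edge of the line
    graph; this agrees with the inequality in \<open>?adj\<close>.\<close>
  have adj: "{es ! i, es ! j} \<in> edges (line_graph (unmarked_graph n \<Gamma>)) \<longleftrightarrow> ?adj (es ! j)"
    if "j < length es" for j
    using i that es(2) nth_mem[of i es] nth_mem[of j es]
    by (auto simp: line_graph_def doubleton_eq_iff simp del: nth_mem)
  have "(P_matrix n \<Gamma> es *\<^sub>v vec (length es) (\<lambda>j. h (es ! j))) $ i =
    (\<Sum>j<length es. (if ?adj (es ! j) then h (es ! j) else 0)) / (2 * (real n - 1))"
    using i by (auto simp: P_matrix_def adjacency_matrix_def scalar_prod_def adj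
        atLeast0LessThan sum_divide_distrib intro!: sum.cong)
  also have "(\<Sum>j<length es. (if ?adj (es ! j) then h (es ! j) else 0)) =
      (\<Sum>f\<in>set es. if ?adj f then h f else 0)"
    \<comment> \<open>Since \<open>es\<close> is distinct, positions in the list correspond
      one-to-one to unmarked edges.\<close>
    by (rule sum.reindex_bij_betw[OF bij_betw_nth[OF es(1) refl refl]])
  also have "\<dots> = (\<Sum>f | f \<in> set es \<and> ?adj f. h f)"
    by (simp add: sum.inter_filter)
  finally show ?thesis .
qed

lemma edges_unmarked_graph:
  "edges (unmarked_graph n \<Gamma>) = {e. e \<subseteq> {..<n + 1} \<and> card e = 2 \<and> e \<notin> edges \<Gamma>}"
  by (auto simp: unmarked_graph_def delete_edges_def complete_graph_def)

lemma marked_subgraphD: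
  assumes "marked_subgraph n \<Gamma>"
  shows "edges \<Gamma> \<subseteq> {e. e \<subseteq> {..<n + 1} \<and> card e = 2}" "edges \<Gamma> \<noteq> {}"
    "finite (edges \<Gamma>)" "finite (verts \<Gamma>)"
    "f \<in> edges \<Gamma> \<Longrightarrow> f \<subseteq> verts \<Gamma> \<and> card f = 2"
proof -
  show *: "edges \<Gamma> \<subseteq> {e. e \<subseteq> {..<n + 1} \<and> card e = 2}"
    using assms by (auto simp: marked_subgraph_def subgraph_of_def complete_graph_def)
  show "edges \<Gamma> \<noteq> {}" using assms by (simp add: marked_subgraph_def)
  show "finite (edges \<Gamma>)" by (rule finite_subset[of _ "Pow {..<n + 1}"]) (use * in auto)
  show "finite (verts \<Gamma>)"
    by (rule finite_subset[of _ "{..<n + 1}"])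
      (use assms in \<open>auto simp: marked_subgraph_def subgraph_of_def complete_graph_def\<close>)
  show "f \<in> edges \<Gamma> \<Longrightarrow> f \<subseteq> verts \<Gamma> \<and> card f = 2"
    using assms by (auto simp: marked_subgraph_def subgraph_of_def simple_graph_def)
qed

lemma marked_edge_weight_le:
  assumes "marked_subgraph n \<Gamma>" "card e = 2"
  shows "edge_weight (edges \<Gamma>) e \<le> 2 * real (card (verts \<Gamma>))"
  using marked_subgraphD(4,5)[OF assms(1)] assms(2) by (intro edge_weight_le)

text \<open>The function h_c of the overview, an approximate hitting time that is smaller next to
  many marked edges. The prefactor normalises the constant term of (I - P) h_c to 1.\<close>

definition test_fun :: "nat \<Rightarrow> nat ugraph \<Rightarrow> real \<Rightarrow> nat set \<Rightarrow> real" where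
  "test_fun n \<Gamma> c e =
     (real n - 1) / (2 * real (card (edges \<Gamma>))) * (c - edge_weight (edges \<Gamma>) e)"

text \<open>The degree 2(n - 1) cancels the constant \<open>c\<close> except in the sum over the
  removed marked neighbours. The summand 1 comes from the total degree \<open>2 * card F\<close> in
  the handshake lemma.\<close>

lemma one_minus_P_mult_test_fun:
  assumes n: "n \<ge> 2" and \<Gamma>: "marked_subgraph n \<Gamma>"
    and es: "distinct es" "set es = edges (unmarked_graph n \<Gamma>)" and i: "i < length es"
  defines "F \<equiv> edges \<Gamma>" and "e \<equiv> es ! i"
  shows "((1\<^sub>m (length es) - P_matrix n \<Gamma> es) *\<^sub>v vec (length es) (\<lambda>j. test_fun n \<Gamma> c (es ! j))) $ i =
    1 + ((\<Sum>u\<in>e. \<Sum>f | f \<in> F \<and> u \<in> f. c - edge_weight F f) - (real n + 1) * edge_weight F e)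
      / (4 * real (card F))"
    (is "?L = 1 + (?S - _) / _")
proof -
  let ?m = "length es" and ?h = "vec (length es) (\<lambda>j. test_fun n \<Gamma> c (es ! j))"
  define b where "b = (real n - 1) / (2 * real (card F))"
  have h: "test_fun n \<Gamma> c f = b * (c - edge_weight F f)" for f
    by (simp add: test_fun_def b_def F_def)
  have g: "real (card F) > 0"
    using marked_subgraphD(2,3)[OF \<Gamma>] by (simp add: F_def card_gt_0_iff)
  have e: "e \<subseteq> {..<n + 1}" "card e = 2" "e \<notin> F"
    using nth_mem[OF i] es(2) by (auto simp: edges_unmarked_graph F_def e_def)
  have P: "P_matrix n \<Gamma> es \<in> carrier_mat ?m ?m"
    by (simp add: P_matrix_def adjacency_matrix_def)
  have "?L = (1\<^sub>m ?m *\<^sub>v ?h - P_matrix n \<Gamma> es *\<^sub>v ?h) $ i"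
    using P by (subst minus_mult_distrib_mat_vec[of _ ?m ?m]) auto
  also have "\<dots> = test_fun n \<Gamma> c e - (P_matrix n \<Gamma> es *\<^sub>v ?h) $ i"
    using P i by (simp add: e_def)
  also have "(P_matrix n \<Gamma> es *\<^sub>v ?h) $ i =
      (\<Sum>f | f \<subseteq> {..<n + 1} \<and> card f = 2 \<and> f \<notin> F \<and> f \<noteq> e \<and> e \<inter> f \<noteq> {}. test_fun n \<Gamma> c f) /
      (2 * (real n - 1))"
    unfolding P_matrix_mult_vec[OF es i]
    by (intro arg_cong2[where f = "(/)"] sum.cong refl)
      (auto simp: es(2) edges_unmarked_graph F_def e_def)
  also have "\<dots> = b * ((real n - 1) * (2 * c - edge_weight F e) -
      2 * (2 * real (card F) - edge_weight F e) - ?S) / (2 * (real n - 1))"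
    unfolding h sum_distrib_left[symmetric]
    using sum_adjacent_weight[of "{..<n + 1}" F e c] e marked_subgraphD(1)[OF \<Gamma>]
    by (simp add: F_def)
  finally have "?L = b * (c - edge_weight F e) - b * ((real n - 1) * (2 * c - edge_weight F e) -
      2 * (2 * real (card F) - edge_weight F e) - ?S) / (2 * (real n - 1))"
    by (simp only: h)
  also have "\<dots> = 1 + (?S - (real n + 1) * edge_weight F e) / (4 * real (card F))"
  proof -
    have "real n - 1 \<noteq> 0" "real (card F) \<noteq> 0" using g n by auto
    then show ?thesis unfolding b_def by (simp add: divide_simps) (simp add: algebra_simps)
  qed
  finally show ?thesis .
qed

text \<open>Marked edges have weight at most n + 1 by the hypothesis on
  \<open>verts \<Gamma>\<close>, so with c = 2(n + 1) each marked term is at least n + 1 and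
  together they outweigh the subtracted multiple of the weight.\<close>

lemma one_minus_P_mult_test_fun_ge:
  assumes "n \<ge> 2" and \<Gamma>: "marked_subgraph n \<Gamma>" and k: "2 * card (verts \<Gamma>) \<le> n + 1"
    and "distinct es" "set es = edges (unmarked_graph n \<Gamma>)" "i < length es"
  shows "((1\<^sub>m (length es) - P_matrix n \<Gamma> es) *\<^sub>v
    vec (length es) (\<lambda>j. test_fun n \<Gamma> (2 * (real n + 1)) (es ! j))) $ i \<ge> 1"
proof -
  have "2 * (real n + 1) - edge_weight (edges \<Gamma>) f \<ge> real n + 1" if "f \<in> edges \<Gamma>" for f
    using marked_edge_weight_le[OF \<Gamma>, of f] marked_subgraphD(5)[OF \<Gamma> that] k
    by fastforce
  from sum_incident_ge[of "edges \<Gamma>", OF this] show ?thesis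
    using assms by (simp add: one_minus_P_mult_test_fun)
qed

lemma one_minus_P_mult_test_fun_le:
  assumes "n \<ge> 2" "marked_subgraph n \<Gamma>"
    and "distinct es" "set es = edges (unmarked_graph n \<Gamma>)" "i < length es"
  shows "((1\<^sub>m (length es) - P_matrix n \<Gamma> es) *\<^sub>v
    vec (length es) (\<lambda>j. test_fun n \<Gamma> (real n - 1) (es ! j))) $ i \<le> 1"
proof -
  let ?F = "edges \<Gamma>" and ?e = "es ! i"
  have "(\<Sum>u\<in>?e. \<Sum>f | f \<in> ?F \<and> u \<in> f. real n - 1 - edge_weight ?F f) \<le>
      (real n - 1) * edge_weight ?F ?e"
    by (rule sum_incident_le) (simp add: edge_weight_nonneg)
  also have "\<dots> \<le> (real n + 1) * edge_weight ?F ?e"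
    by (simp add: edge_weight_nonneg mult_right_mono)
  finally show ?thesis
    using assms by (simp add: one_minus_P_mult_test_fun divide_nonpos_nonneg)
qed

section \<open>Bounds on the searching time\<close>

lemma unmarked_graph_edges_nonempty:
  assumes \<Gamma>: "marked_subgraph n \<Gamma>" and k: "card (verts \<Gamma>) \<le> n" and n: "n \<ge> 1"
  shows "edges (unmarked_graph n \<Gamma>) \<noteq> {}"
proof -
  have "\<not> {..<n + 1} \<subseteq> verts \<Gamma>"
    using card_mono[OF marked_subgraphD(4)[OF \<Gamma>], of "{..<n + 1}"] k by auto
  then obtain x where x: "x < n + 1" "x \<notin> verts \<Gamma>" by auto
  \<comment> \<open>One of 0 and 1 differs from \<open>x\<close>. As \<open>x\<close> lies outside
    \<open>verts \<Gamma>\<close>, the edge \<open>{x, y}\<close> is unmarked.\<close>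
  obtain y where y: "y < n + 1" "y \<noteq> x"
    using that[of 0] that[of 1] n by fastforce
  have "{x, y} \<in> edges (unmarked_graph n \<Gamma>)"
    using x y marked_subgraphD(5)[OF \<Gamma>, of "{x, y}"] by (auto simp: edges_unmarked_graph)
  then show ?thesis by blast
qed

text \<open>The searching time is the mean over all unmarked edges of the solution \<open>t\<close>
  of (I - P) t = 1, so uniform bounds on the two test functions enclosing \<open>t\<close> carry
  over to it.\<close>

lemma classical_time_bounds:
  assumes n: "n \<ge> 2" and \<Gamma>: "marked_subgraph n \<Gamma>" and k: "2 * card (verts \<Gamma>) \<le> n + 1"
    and es: "distinct es" "set es = edges (unmarked_graph n \<Gamma>)"
    and lower: "\<And>e. e \<in> set es \<Longrightarrow> L \<le> test_fun n \<Gamma> (real n - 1) e"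
    and upper: "\<And>e. e \<in> set es \<Longrightarrow> test_fun n \<Gamma> (2 * (real n + 1)) e \<le> U"
  shows "L \<le> classical_time n \<Gamma> es" "classical_time n \<Gamma> es \<le> U"
proof -
  define m where "m = length es"
  define M where "M = 1\<^sub>m m - P_matrix n \<Gamma> es"
  define lo where "lo = vec m (\<lambda>j. test_fun n \<Gamma> (real n - 1) (es ! j))"
  let ?hi = "\<lambda>j. test_fun n \<Gamma> (2 * (real n + 1)) (es ! j)"
  define hi where "hi = vec m ?hi"
  have lohi: "lo \<in> carrier_vec m" "hi \<in> carrier_vec m" by (auto simp: lo_def hi_def)
  have P: "P_matrix n \<Gamma> es \<in> carrier_mat m m"
    by (simp add: P_matrix_def adjacency_matrix_def m_def)
  have M: "M \<in> carrier_mat m m" using P unfolding M_def by (intro minus_carrier_mat)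
  have off: "M $$ (i, j) \<le> 0" if "i < m" "j < m" "i \<noteq> j" for i j
    using that n by (simp add: M_def P_matrix_def adjacency_matrix_def m_def)
  have g: "real (card (edges \<Gamma>)) > 0"
    using marked_subgraphD(2,3)[OF \<Gamma>] by (simp add: card_gt_0_iff)
  have hi_pos: "?hi i > 0" if "i < m" for i
  proof -
    have "card (es ! i) = 2"
      using nth_mem[of i es] that es(2) by (auto simp: edges_unmarked_graph m_def)
    then have "edge_weight (edges \<Gamma>) (es ! i) \<le> 2 * real (card (verts \<Gamma>))"
      by (rule marked_edge_weight_le[OF \<Gamma>])
    then show ?thesis using k n g by (auto simp: test_fun_def intro!: mult_pos_pos divide_pos_pos)
  qed
  have Mhi: "(M *\<^sub>v hi) $ i \<ge> 1" if "i < m" for i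
    using one_minus_P_mult_test_fun_ge[OF n \<Gamma> k es] that by (simp add: M_def hi_def m_def)
  have Mlo: "(M *\<^sub>v lo) $ i \<le> 1" if "i < m" for i
    using one_minus_P_mult_test_fun_le[OF n \<Gamma> es] that by (simp add: M_def lo_def m_def)
  have Mhi_pos: "(M *\<^sub>v vec m ?hi) $ i > 0" if "i < m" for i
    using Mhi[OF that] by (simp add: hi_def)
  \<comment> \<open>The upper test function is positive with positive image under \<open>M\<close>,
    so it is the comparison vector here and in both uses of the minimum principle below.\<close>
  obtain B where B: "mat_inverse M = Some B" "B \<in> carrier_mat m m" "M * B = 1\<^sub>m m"
    by (rule mat_inverse_if_mult_pos[OF M off hi_pos Mhi_pos])
  define one where "one = (vec m (\<lambda>_. 1) :: real vec)"
  define t where "t = B *\<^sub>v one"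
  have one: "one \<in> carrier_vec m" by (simp add: one_def)
  have t: "t \<in> carrier_vec m" using B(2) one unfolding t_def by (rule mult_mat_vec_carrier)
  have Mt: "M *\<^sub>v t = one"
    using assoc_mult_mat_vec[OF M B(2) one] B(3) one by (simp add: t_def)
  have t_hi: "t $ i \<le> hi $ i" if i: "i < m" for i
  proof -
    \<comment> \<open>Here \<open>M\<close> maps \<open>hi - t\<close> to \<open>M hi - 1\<close>,
      which is nonnegative; below it maps \<open>t - lo\<close> to \<open>1 - M lo\<close>.\<close>
    have "(hi - t) $ i \<ge> 0"
      using Mhi M t lohi
      by (intro nonneg_if_mult_nonneg[OF M _ off hi_pos Mhi_pos _ i])
        (auto simp: mult_minus_distrib_mat_vec[OF M] Mt one_def simp del: index_mult_mat_vec)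
    then show ?thesis using i t lohi by simp
  qed
  have t_lo: "lo $ i \<le> t $ i" if i: "i < m" for i
  proof -
    have "(t - lo) $ i \<ge> 0"
      using Mlo M t lohi
      by (intro nonneg_if_mult_nonneg[OF M _ off hi_pos Mhi_pos _ i])
        (auto simp: mult_minus_distrib_mat_vec[OF M] Mt one_def simp del: index_mult_mat_vec)
    then show ?thesis using i t lohi by simp
  qed
  \<comment> \<open>Positivity of \<open>m\<close> is needed to divide by it in the mean.\<close>
  have "es \<noteq> []"
    using unmarked_graph_edges_nonempty[OF \<Gamma>] es(2) k n by fastforce
  then have m: "m > 0" by (simp add: m_def)
  have "unit_ones_vec m = (1 / sqrt (real m)) \<cdot>\<^sub>v one"
    by (auto simp: unit_ones_vec_def one_def)
  then have "classical_time n \<Gamma> es = 1 / sqrt (real m) * (1 / sqrt (real m)) * (one \<bullet> t)"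
    using B one t
    by (simp add: classical_time_def Let_def m_def[symmetric] M_def[symmetric]
        mult_mat_vec[OF B(2) one] t_def[symmetric])
  also have "one \<bullet> t = (\<Sum>i<m. t $ i)"
    using t by (auto simp: scalar_prod_def one_def atLeast0LessThan)
  finally have T: "classical_time n \<Gamma> es = (\<Sum>i<m. t $ i) / m"
    by simp
  have "L \<le> t $ i" "t $ i \<le> U" if "i < m" for i
    using t_lo[OF that] t_hi[OF that] lower[OF nth_mem, of i] upper[OF nth_mem, of i] that
    by (auto simp: lo_def hi_def m_def)
  then have "real m * L \<le> (\<Sum>i<m. t $ i)" "(\<Sum>i<m. t $ i) \<le> real m * U"
    using sum_bounded_below[of "{..<m}" L "\<lambda>i. t $ i"]
      sum_bounded_above[of "{..<m}" "\<lambda>i. t $ i" U] by auto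
  then show "L \<le> classical_time n \<Gamma> es" "classical_time n \<Gamma> es \<le> U"
    unfolding T using m by (auto simp: field_simps)
qed

theorem theorem5p3:
  shows "\<exists>c1 c2 :: real. 0 < c1 \<and> c1 \<le> c2 \<and>
    (\<forall>(n :: nat) (\<Gamma> :: nat ugraph).
       n \<ge> 2 \<longrightarrow> marked_subgraph n \<Gamma> \<longrightarrow> 64 * card (verts \<Gamma>) \<le> n + 1 \<longrightarrow>
       (\<forall>es \<in> permutations_of_set (edges (unmarked_graph n \<Gamma>)).
          c1 * ((real n)\<^sup>2 / real (card (edges \<Gamma>))) \<le> classical_time n \<Gamma> es \<and>
          classical_time n \<Gamma> es \<le> c2 * ((real n)\<^sup>2 / real (card (edges \<Gamma>)))))"
proof -
  have "1 / 8 * ((real n)\<^sup>2 / real (card (edges \<Gamma>))) \<le> classical_time n \<Gamma> es \<and>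
      classical_time n \<Gamma> es \<le> 1 * ((real n)\<^sup>2 / real (card (edges \<Gamma>)))"
    if n: "n \<ge> 2" and \<Gamma>: "marked_subgraph n \<Gamma>" and k: "64 * card (verts \<Gamma>) \<le> n + 1"
      and es: "es \<in> permutations_of_set (edges (unmarked_graph n \<Gamma>))" for n \<Gamma> es
  proof -
    define g where "g = real (card (edges \<Gamma>))"
    have g: "g > 0"
      using marked_subgraphD(2,3)[OF \<Gamma>] by (simp add: g_def card_gt_0_iff)
    have es: "distinct es" "set es = edges (unmarked_graph n \<Gamma>)"
      using es by (auto simp: permutations_of_set_def)
    obtain f where "f \<in> edges \<Gamma>" using marked_subgraphD(2)[OF \<Gamma>] by blast
    then have "verts \<Gamma> \<noteq> {}" using marked_subgraphD(5)[OF \<Gamma>] by fastforce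
    then have "card (verts \<Gamma>) > 0"
      using marked_subgraphD(4)[OF \<Gamma>] by (simp add: card_gt_0_iff)
    \<comment> \<open>A nonempty vertex set forces n + 1 to be at least 64.\<close>
    then have n63: "real n \<ge> 63" using k by linarith
    have w: "edge_weight (edges \<Gamma>) e \<le> (real n + 1) / 32" if "e \<in> set es" for e
    proof -
      have "card e = 2" using that es(2) by (simp add: edges_unmarked_graph)
      then have "edge_weight (edges \<Gamma>) e \<le> 2 * real (card (verts \<Gamma>))"
        by (rule marked_edge_weight_le[OF \<Gamma>])
      moreover have "64 * real (card (verts \<Gamma>)) \<le> real n + 1" using k by linarith
      ultimately show ?thesis by simp
    qed
    have lower: "1 / 8 * ((real n)\<^sup>2 / g) \<le> test_fun n \<Gamma> (real n - 1) e" if "e \<in> set es" for e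
    proof -
      \<comment> \<open>Both n - 1 and n - 1 - (n + 1)/32 are at least n/2; with the 2 in the
        prefactor this gives 1/8.\<close>
      have "1 / 8 * ((real n)\<^sup>2 / g) = (real n / 2) / (2 * g) * (real n / 2)"
        by (simp add: power2_eq_square)
      also have "\<dots> \<le> test_fun n \<Gamma> (real n - 1) e"
        unfolding test_fun_def g_def[symmetric] using g n63 w[OF that]
        by (intro mult_mono divide_right_mono) auto
      finally show ?thesis .
    qed
    have upper: "test_fun n \<Gamma> (2 * (real n + 1)) e \<le> 1 * ((real n)\<^sup>2 / g)" for e
    proof -
      \<comment> \<open>Dropping the nonnegative weight leaves (n - 1)(n + 1)/g, hence the constant
        1.\<close>
      have "test_fun n \<Gamma> (2 * (real n + 1)) e \<le> (real n - 1) / (2 * g) * (2 * (real n + 1))"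
        unfolding test_fun_def g_def[symmetric] using g n63
        by (intro mult_left_mono) (auto simp: edge_weight_nonneg)
      also have "\<dots> = ((real n)\<^sup>2 - 1) / g"
        using g by (simp add: field_simps power2_eq_square)
      also have "\<dots> \<le> 1 * ((real n)\<^sup>2 / g)" using g by (simp add: divide_right_mono)
      finally show ?thesis .
    qed
    show ?thesis
      using classical_time_bounds[OF n \<Gamma> _ es lower upper] k by (simp add: g_def)
  qed
  then show ?thesis by (intro exI[of _ "1 / 8"] exI[of _ 1]) auto
qed

end
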